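(* For every integer $k\ge 1$ and every $\epsilon>0$ we have $F_k(x)=x\,P_k^F(\log x)+\Delta_k^F(x)$ for $x\ge 1$, where $$P_k^F(t)=\sum_{j=0}^{k-1}b_{k,j}\,t^j,\qquad b_{k,j}=\sum_{i=j+1}^{k}(-1)^{k-i}\binom{k}{i}a_{i,j},$$ $$\Delta_k^F(x)=O\!\left(x^{\beta_k+\epsilon}\right)\quad (x\to\infty),\qquad \beta_k=\max_{1\le j\le k}\alpha_j ,$$ with $\alpha_j=\frac{j-1}{j}$, the implied constant depending only on $k$ and $\epsilon$. Here the $a_{i,j}$ are the coefficients in the divisor problem as defined in the context.
   Context: For integers $n,k\ge1$: $d_k(n)$ is the number of $k$-tuples of positive integers with product $n$, and $f_k(n)$ is the number of $k$-tuples of integers, each $\ge 2$, with product $n$. For real $x\ge1$: $D_k(x)=\sum_{n\le x}d_k(n)$ and $F_k(x)=\sum_{n\le x}f_k(n)$. With $\alpha_k=\frac{k-1}{k}$, the following is known: for each $k\ge 1$ there exist (necessarily unique) real numbers $a_{k,0},\dots,a_{k,k-1}$ such that for every $\epsilon>0$, $D_k(x)=x\sum_{j=0}^{k-1}a_{k,j}(\log x)^j+O(x^{\alpha_k+\epsilon})$ as $x\to\infty$. These are the coefficients $a_{k,j}$ in the claim (e.g. $a_{1,0}=1$). *)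

theory Defs
  imports Complex_Main "HOL-Library.Landau_Symbols"
begin

definition d :: "nat \<Rightarrow> nat \<Rightarrow> nat" where
  "d k n = card {xs :: nat list. length xs = k \<and> (\<forall>m\<in>set xs. m \<ge> 1) \<and> prod_list xs = n}"

definition f :: "nat \<Rightarrow> nat \<Rightarrow> nat" where
  "f k n = card {xs :: nat list. length xs = k \<and> (\<forall>m\<in>set xs. m \<ge> 2) \<and> prod_list xs = n}"

definition D :: "nat \<Rightarrow> real \<Rightarrow> real" where
  "D k x = (\<Sum>n | 1 \<le> n \<and> real n \<le> x. real (d k n))"

definition F :: "nat \<Rightarrow> real \<Rightarrow> real" where
  "F k x = (\<Sum>n | 1 \<le> n \<and> real n \<le> x. real (f k n))"

definition \<alpha> :: "nat \<Rightarrow> real" where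
  "\<alpha> k = (real k - 1) / real k"

definition \<beta> :: "nat \<Rightarrow> real" where
  "\<beta> k = Max (\<alpha> ` {1..k})"

text \<open>The known asymptotics of the divisor problem determine the coefficients \<open>a k j\<close>
  with \<open>k \<ge> 1\<close> and \<open>j < k\<close> uniquely; the values of \<open>a\<close> at other indices are irrelevant,
  here and in \<open>b\<close> below.\<close>

definition divisor_coeffs :: "(nat \<Rightarrow> nat \<Rightarrow> real) \<Rightarrow> bool" where
  "divisor_coeffs a \<longleftrightarrow>
     (\<forall>k\<ge>1. \<forall>\<epsilon>>0.
        (\<lambda>x. D k x - x * (\<Sum>j<k. a k j * ln x ^ j)) \<in> O[at_top](\<lambda>x. x powr (\<alpha> k + \<epsilon>)))"

definition b :: "(nat \<Rightarrow> nat \<Rightarrow> real) \<Rightarrow> nat \<Rightarrow> nat \<Rightarrow> real" where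
  "b a k j = (\<Sum>i=j+1..k. (-1) ^ (k - i) * real (k choose i) * a i j)"

definition P\<^sub>F :: "(nat \<Rightarrow> nat \<Rightarrow> real) \<Rightarrow> nat \<Rightarrow> real \<Rightarrow> real" where
  "P\<^sub>F a k t = (\<Sum>j<k. b a k j * t ^ j)"

end

theory Submission
  imports Defs
begin

text \<open>
  Splitting off the first entry of a tuple gives, for \<open>n \<ge> 1\<close>,
  \<open>d (k+1) n = (\<Sum>m | m dvd n. d k (n div m))\<close>, and the same recursion for \<open>f\<close> with \<open>m\<close>
  restricted to \<open>m \<ge> 2\<close>. The term \<open>m = 1\<close> of the former is \<open>d k n\<close>, so the difference operator
  \<open>u \<mapsto> (\<lambda>k. u (k+1) - u k)\<close>, applied to \<open>d\<close> in its first argument, reproduces the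
  recursion of \<open>f\<close>. Iterating it yields the binomial inversion
  \<open>f k n = (\<Sum>i\<le>k. (-1)^(k-i) * (k choose i) * d i n)\<close> (lemma \<open>f_eq_alternating_sum_d\<close>; in terms
  of Dirichlet series this is the expansion of \<open>(\<zeta>(s) - 1)^k\<close>), and, after summation over
  \<open>n \<le> x\<close>, the same relation between \<open>F\<close> and \<open>D\<close>.

  Inserting the asymptotics of \<open>D i\<close> for \<open>1 \<le> i \<le> k\<close>, the main terms combine to \<open>x * P\<^sub>F a k (ln x)\<close>
  by exchanging the order of summation over \<open>i\<close> and \<open>j\<close>, and the error terms are all
  \<open>O(x powr (\<beta> k + \<epsilon>))\<close> since \<open>\<alpha> i \<le> \<beta> k\<close>. The term \<open>i = 0\<close> contributes
  \<open>(-1)^k * D 0 x\<close>, which is the constant \<open>(-1)^k\<close> for \<open>x \<ge> 1\<close> and is absorbed into the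
  error because \<open>\<beta> k \<ge> \<alpha> 1 = 0\<close>.
\<close>

text \<open>The common generalisation of the sets counted by \<open>d\<close> (\<open>c = 1\<close>) and \<open>f\<close> (\<open>c = 2\<close>): the
  ordered factorisations of \<open>n\<close> into \<open>k\<close> factors, each at least \<open>c\<close>.\<close>

definition factorisations :: "nat \<Rightarrow> nat \<Rightarrow> nat \<Rightarrow> nat list set" where
  "factorisations c k n = {xs. length xs = k \<and> (\<forall>m\<in>set xs. m \<ge> c) \<and> prod_list xs = n}"

lemma d_eq_card_factorisations: "d k n = card (factorisations 1 k n)"
  by (simp add: d_def factorisations_def)

lemma f_eq_card_factorisations: "f k n = card (factorisations 2 k n)"
  by (simp add: f_def factorisations_def)

lemma finite_factorisations:
  assumes "n \<ge> 1"
  shows "finite (factorisations c k n)"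
proof (rule finite_subset)
  show "factorisations c k n \<subseteq> {xs. set xs \<subseteq> {..n} \<and> length xs = k}"
    using assms by (auto simp: factorisations_def intro!: dvd_imp_le prod_list_dvd)
  show "finite {xs. set xs \<subseteq> {..n} \<and> length xs = k}"
    by (rule finite_lists_length_eq) simp
qed

lemma factorisations_0: "factorisations c 0 n = (if n = 1 then {[]} else {})"
  by (auto simp: factorisations_def)

lemma factorisations_Suc:
  assumes "n \<ge> 1"
  shows "factorisations c (Suc k) n =
           (\<Union>m\<in>{m. m dvd n \<and> m \<ge> c}. (#) m ` factorisations c k (n div m))"
    (is "?L = ?R")
proof
  show "?L \<subseteq> ?R"
  proof
    fix xs assume "xs \<in> ?L"
    then obtain m ys where xs: "xs = m # ys" and ys: "length ys = k" "\<forall>y\<in>set ys. y \<ge> c"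
      and m: "m \<ge> c" and n: "n = m * prod_list ys"
      by (cases xs) (auto simp: factorisations_def)
    have "m \<noteq> 0" using n assms by auto
    hence "n div m = prod_list ys" using n by simp
    hence "ys \<in> factorisations c k (n div m)"
      using ys by (simp add: factorisations_def)
    moreover have "m dvd n"
      using n by simp
    ultimately show "xs \<in> ?R"
      using xs m by blast
  qed
  show "?R \<subseteq> ?L" by (auto simp: factorisations_def)
qed

lemma card_factorisations_Suc:
  assumes "n \<ge> 1"
  shows "card (factorisations c (Suc k) n) =
           (\<Sum>m | m dvd n \<and> m \<ge> c. card (factorisations c k (n div m)))"
proof -
  have fin: "finite {m. m dvd n \<and> m \<ge> c}"
    using assms by simp
  have "n div m \<ge> 1" if "m dvd n" for m
    using assms that by auto
  hence "card (factorisations c (Suc k) n) =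
           (\<Sum>m | m dvd n \<and> m \<ge> c. card ((#) m ` factorisations c k (n div m)))"
    unfolding factorisations_Suc[OF assms]
    by (intro card_UN_disjoint fin) (auto intro!: finite_factorisations)
  thus ?thesis by (simp add: card_image)
qed

lemma d_Suc_diff:
  assumes "n \<ge> 1"
  shows "real (d (Suc k) n) - real (d k n) = (\<Sum>m | m dvd n \<and> m \<ge> 2. real (d k (n div m)))"
proof -
  have "{m. m dvd n \<and> m \<ge> 1} = insert 1 {m. m dvd n \<and> m \<ge> 2}"
    using assms by auto
  moreover have "finite {m. m dvd n \<and> m \<ge> 2}"
    using assms by simp
  ultimately have "d (Suc k) n = d k n + (\<Sum>m | m dvd n \<and> m \<ge> 2. d k (n div m))"
    using card_factorisations_Suc[OF assms, of 1 k] by (simp add: d_eq_card_factorisations)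
  thus ?thesis by simp
qed

text \<open>By Pascal's rule, the \<open>(k+1)\<close>-st iterated difference of \<open>u\<close> at \<open>0\<close> is the \<open>k\<close>-th iterated
  difference of the sequence of differences \<open>u (i+1) - u i\<close>.\<close>

lemma alternating_binomial_sum_Suc:
  fixes u :: "nat \<Rightarrow> real"
  shows "(\<Sum>i\<le>Suc k. (-1) ^ (Suc k - i) * real (Suc k choose i) * u i) =
         (\<Sum>i\<le>k. (-1) ^ (k - i) * real (k choose i) * (u (Suc i) - u i))"
proof -
  have shift: "(-1) ^ Suc k * u 0 + (\<Sum>i\<le>k. (-1) ^ (k - i) * real (k choose Suc i) * u (Suc i)) =
        (\<Sum>i\<le>Suc k. (-1) ^ (Suc k - i) * real (k choose i) * u i)"
    by (subst sum.atMost_Suc_shift) simp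
  have "(\<Sum>i\<le>Suc k. (-1) ^ (Suc k - i) * real (Suc k choose i) * u i) =
        (-1) ^ Suc k * u 0 + (\<Sum>i\<le>k. (-1) ^ (k - i) * real (Suc k choose Suc i) * u (Suc i))"
    by (subst sum.atMost_Suc_shift) simp
  also have "\<dots> = (\<Sum>i\<le>k. (-1) ^ (k - i) * real (k choose i) * u (Suc i)) +
        ((-1) ^ Suc k * u 0 + (\<Sum>i\<le>k. (-1) ^ (k - i) * real (k choose Suc i) * u (Suc i)))"
    by (simp add: algebra_simps sum.distrib)
  also note shift
  also have "(\<Sum>i\<le>Suc k. (-1) ^ (Suc k - i) * real (k choose i) * u i) =
        (\<Sum>i\<le>k. - ((-1) ^ (k - i) * real (k choose i) * u i))"
    by (auto simp: Suc_diff_le intro!: sum.cong)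
  finally show ?thesis
    by (simp add: right_diff_distrib sum_subtractf sum_negf)
qed

lemma f_eq_alternating_sum_d:
  assumes "n \<ge> 1"
  shows "real (f k n) = (\<Sum>i\<le>k. (-1) ^ (k - i) * real (k choose i) * real (d i n))"
  using assms
proof (induction k arbitrary: n)
  case 0
  show ?case
    by (simp add: d_eq_card_factorisations f_eq_card_factorisations factorisations_0)
next
  case (Suc k)
  have pos: "n div m \<ge> 1" if "m dvd n" for m
    using Suc.prems that by auto
  have "real (f (Suc k) n) = (\<Sum>m | m dvd n \<and> m \<ge> 2. real (f k (n div m)))"
    using card_factorisations_Suc[OF Suc.prems, of 2 k] by (simp add: f_eq_card_factorisations)
  also have "\<dots> = (\<Sum>m | m dvd n \<and> m \<ge> 2.
                    \<Sum>i\<le>k. (-1) ^ (k - i) * real (k choose i) * real (d i (n div m)))"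
    by (intro sum.cong refl Suc.IH) (use pos in blast)
  also have "\<dots> = (\<Sum>i\<le>k. (-1) ^ (k - i) * real (k choose i) *
                    (\<Sum>m | m dvd n \<and> m \<ge> 2. real (d i (n div m))))"
    by (subst sum.swap) (simp add: sum_distrib_left)
  also have "\<dots> = (\<Sum>i\<le>k. (-1) ^ (k - i) * real (k choose i) * (real (d (Suc i) n) - real (d i n)))"
    by (simp add: d_Suc_diff[OF Suc.prems])
  finally show ?case
    by (simp only: alternating_binomial_sum_Suc)
qed

lemma F_eq_alternating_sum_D:
  "F k x = (\<Sum>i\<le>k. (-1) ^ (k - i) * real (k choose i) * D i x)"
proof -
  have "F k x = (\<Sum>n | 1 \<le> n \<and> real n \<le> x.
                  \<Sum>i\<le>k. (-1) ^ (k - i) * real (k choose i) * real (d i n))"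
    unfolding F_def by (intro sum.cong refl f_eq_alternating_sum_d) simp
  also have "\<dots> = (\<Sum>i\<le>k. (-1) ^ (k - i) * real (k choose i) * D i x)"
    unfolding D_def by (subst sum.swap) (simp add: sum_distrib_left)
  finally show ?thesis .
qed

text \<open>The empty tuple, with product \<open>1\<close>, is the only tuple of length \<open>0\<close>.\<close>

lemma D_0:
  assumes "x \<ge> 1"
  shows "D 0 x = 1"
proof -
  have fin: "finite {n. 1 \<le> n \<and> real n \<le> x}"
    by (rule finite_subset[of _ "{..nat \<lfloor>x\<rfloor>}"]) (auto simp: le_nat_floor)
  have "D 0 x = (\<Sum>n | 1 \<le> n \<and> real n \<le> x. if n = 1 then 1 else 0)"
    unfolding D_def
    by (intro sum.cong refl) (simp add: d_eq_card_factorisations factorisations_0)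
  also have "\<dots> = 1"
    using assms by (subst sum.delta[OF fin]) simp
  finally show ?thesis .
qed

lemma P\<^sub>F_eq_alternating_sum:
  "P\<^sub>F a k t = (\<Sum>i=1..k. (-1) ^ (k - i) * real (k choose i) * (\<Sum>j<i. a i j * t ^ j))"
proof -
  let ?g = "\<lambda>i j. (-1) ^ (k - i) * real (k choose i) * a i j * t ^ j"
  have "P\<^sub>F a k t = (\<Sum>j<k. \<Sum>i=j+1..k. ?g i j)"
    by (simp add: P\<^sub>F_def b_def sum_distrib_right)
  also have "\<dots> = (\<Sum>i=1..k. \<Sum>j<i. ?g i j)"
    unfolding sum.Sigma[OF finite_lessThan ballI[OF finite_atLeastAtMost]]
      sum.Sigma[OF finite_atLeastAtMost ballI[OF finite_lessThan]]
    by (rule sum.reindex_bij_witness[of _ "\<lambda>(i, j). (j, i)" "\<lambda>(j, i). (i, j)"]) auto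
  finally show ?thesis
    by (simp add: sum_distrib_left mult.assoc)
qed

lemma \<alpha>_le_\<beta>:
  assumes "1 \<le> i" "i \<le> k"
  shows "\<alpha> i \<le> \<beta> k"
  unfolding \<beta>_def using assms by (intro Max_ge) auto

lemma \<beta>_nonneg:
  assumes "k \<ge> 1"
  shows "\<beta> k \<ge> 0"
  using \<alpha>_le_\<beta>[of 1 k] assms by (simp add: \<alpha>_def)

lemma powr_bigo_powr_at_top:
  fixes p q :: real
  assumes "p \<le> q"
  shows "(\<lambda>x. x powr p) \<in> O[at_top](\<lambda>x. x powr q)"
  by (intro landau_o.big_mono eventually_mono[OF eventually_ge_at_top[of 1]])
    (use assms in \<open>simp add: powr_mono\<close>)

theorem theorem4p2:
  fixes a :: "nat \<Rightarrow> nat \<Rightarrow> real" and k :: nat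
  assumes "divisor_coeffs a" and "k \<ge> 1"
  shows "\<exists>\<Delta> :: real \<Rightarrow> real.
           (\<forall>x\<ge>1. F k x = x * P\<^sub>F a k (ln x) + \<Delta> x) \<and>
           (\<forall>\<epsilon>>0. \<Delta> \<in> O[at_top](\<lambda>x. x powr (\<beta> k + \<epsilon>)))"
proof -
  define E where "E i x = D i x - x * (\<Sum>j<i. a i j * ln x ^ j)" for i and x :: real
  define \<Delta> where
    "\<Delta> x = (-1) ^ k + (\<Sum>i=1..k. (-1) ^ (k - i) * real (k choose i) * E i x)" for x
  have "F k x = x * P\<^sub>F a k (ln x) + \<Delta> x" if "x \<ge> 1" for x
  proof -
    have "{..k} = insert 0 {1..k}"
      by auto
    hence "F k x = (-1) ^ k + (\<Sum>i=1..k. (-1) ^ (k - i) * real (k choose i) * D i x)"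
      using D_0[OF that] by (simp add: F_eq_alternating_sum_D)
    also have "\<dots> = x * P\<^sub>F a k (ln x) + \<Delta> x"
      by (simp add: \<Delta>_def E_def P\<^sub>F_eq_alternating_sum right_diff_distrib sum_subtractf
          sum_distrib_left mult_ac)
    finally show ?thesis .
  qed
  moreover have "\<Delta> \<in> O[at_top](\<lambda>x. x powr (\<beta> k + \<epsilon>))" if "\<epsilon> > 0" for \<epsilon>
  proof -
    have "E i \<in> O[at_top](\<lambda>x. x powr (\<beta> k + \<epsilon>))" if i: "i \<in> {1..k}" for i
    proof -
      have "E i \<in> O[at_top](\<lambda>x. x powr (\<alpha> i + \<epsilon>))"
        using assms(1) i \<open>\<epsilon> > 0\<close> by (simp add: divisor_coeffs_def E_def[abs_def])
      also have "(\<lambda>x. x powr (\<alpha> i + \<epsilon>)) \<in> O[at_top](\<lambda>x. x powr (\<beta> k + \<epsilon>))"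
        using i \<alpha>_le_\<beta>[of i k] by (intro powr_bigo_powr_at_top) simp
      finally show ?thesis .
    qed
    hence sum: "(\<lambda>x. \<Sum>i=1..k. (-1) ^ (k - i) * real (k choose i) * E i x)
                  \<in> O[at_top](\<lambda>x. x powr (\<beta> k + \<epsilon>))"
      by (intro big_sum_in_bigo) simp
    have "(\<lambda>x::real. (-1) ^ k :: real) \<in> O[at_top](\<lambda>x. x powr 0)"
      using eventually_gt_at_top[of "0::real"]
      by (intro landau_o.big_mono) (auto elim!: eventually_mono)
    also have "(\<lambda>x::real. x powr 0) \<in> O[at_top](\<lambda>x. x powr (\<beta> k + \<epsilon>))"
      using \<beta>_nonneg[OF assms(2)] \<open>\<epsilon> > 0\<close> by (intro powr_bigo_powr_at_top) simp
    finally show ?thesis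
      unfolding \<Delta>_def[abs_def] using sum by (intro sum_in_bigo)
  qed
  ultimately show ?thesis
    by blast
qed

end
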